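(* Let $\mathcal{A}$ be a unital $C^*$-algebra and let $\mathcal{F}\subseteq\mathcal{A}\cong B(\mathcal{A})$ be an ideal of finite type elements. Let $F\in\mathcal{M}\mathcal{K}\Phi_{+}(\mathcal{A})$ and suppose that $$\mathcal{A}=M_1\tilde\oplus N_1\stackrel{F}{\longrightarrow}M_2\tilde\oplus N_2=\mathcal{A},$$ $$\mathcal{A}=M_1'\tilde\oplus N_1'\stackrel{F}{\longrightarrow}M_2'\tilde\oplus N_2'=\mathcal{A}$$ are two $\mathcal{M}\mathcal{K}\Phi_{+}$-decompositions for $F$. If $P_{N_2}\in\mathcal{F}$, then $P_{N_2'}\in\mathcal{F}$.
   Context: $\mathcal{A}$ is regarded as a right Hilbert module over itself and $B(\mathcal{A})$ is the $C^*$-algebra of all bounded $\mathcal{A}$-linear operators on $\mathcal{A}$ (all are adjointable). The map $a\mapsto L_a$ (left multiplication by $a$) is an isometric $*$-isomorphism $\mathcal{A}\to B(\mathcal{A})$, and $\mathcal{A}$ is identified with $B(\mathcal{A})$ through it; accordingly $\mathcal{F}$ is identified with its image in $B(\mathcal{A})$. Ideal of finite type elements: a subalgebra $\mathcal{F}\subseteq\mathcal{A}$ such that (i) $\mathcal{F}$ is a selfadjoint (two-sided) ideal in $\mathcal{A}$; (ii) there is an approximate unit $\{P_\alpha\}$ for $\mathcal{F}$, contained in $\mathcal{F}$, consisting of (orthogonal) projections; (iii) if $p,q\in\mathcal{F}$ are projections, then there exists $v\in\mathcal{A}$ such that $vv^*=q$ and $v^*v\perp p$, i.e. $v^*v+p$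 is a projection as well. For closed submodules $M_1,M_2$ of a Hilbert module $M$, $M=M_1\tilde\oplus M_2$ means $M_1\cap M_2=\{0\}$ and $M_1+M_2=M$ (not necessarily orthogonal). A closed submodule is complementable if it is a summand in such a decomposition. Every closed complementable submodule $M$ of $\mathcal{A}$ is orthogonally complementable; $P_M$ denotes the orthogonal projection onto $M$. An $\mathcal{M}\mathcal{K}\Phi_+$-decomposition for $F\in B(\mathcal{A})$ is a decomposition $\mathcal{A}=M_1\tilde\oplus N_1\stackrel{F}{\longrightarrow}M_2\tilde\oplus N_2=\mathcal{A}$ (closed submodules) with respect to which $F$ has the matrix $\begin{pmatrix}F_1&0\\0&F_4\end{pmatrix}$, where $F_1:M_1\to M_2$ is an isomorphism (bounded $\mathcal{A}$-linear bijection with bounded inverse) and $P_{N_1}\in\mathcal{F}$. $\mathcal{M}\mathcal{K}\Phi_+(\mathcal{A})$ is the set of all $F\in B(\mathcal{A})$ admitting such a decomposition. *)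

theory Defs
  imports "HOL-Analysis.Analysis"
begin

text \<open>Unital $C^*$-algebras. The library has no complex normed spaces, so the complex structure
  is added on top of the real Banach algebra classes. As \<^class>\<open>real_normed_algebra_1\<close> demands
  \<^prop>\<open>norm 1 = 1\<close>, the zero algebra is excluded.\<close>

class cstar_algebra_1 = real_normed_algebra_1 + banach +
  fixes scaleC :: "complex \<Rightarrow> 'a \<Rightarrow> 'a"  (infixr "*\<^sub>C" 75)
    and star :: "'a \<Rightarrow> 'a"
  assumes scaleC_add_right: "c *\<^sub>C (x + y) = c *\<^sub>C x + c *\<^sub>C y"
    and scaleC_add_left: "(c + d) *\<^sub>C x = c *\<^sub>C x + d *\<^sub>C x"
    and scaleC_scaleC: "c *\<^sub>C (d *\<^sub>C x) = (c * d) *\<^sub>C x"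
    and scaleR_scaleC: "r *\<^sub>R x = complex_of_real r *\<^sub>C x"
    and mult_scaleC_left: "(c *\<^sub>C x) * y = c *\<^sub>C (x * y)"
    and mult_scaleC_right: "x * (c *\<^sub>C y) = c *\<^sub>C (x * y)"
    and norm_scaleC: "norm (c *\<^sub>C x) = cmod c * norm x"
    and star_star: "star (star x) = x"
    and star_add: "star (x + y) = star x + star y"
    and star_scaleC: "star (c *\<^sub>C x) = cnj c *\<^sub>C star x"
    and star_mult: "star (x * y) = star y * star x"
    and norm_star_mult_self: "norm (star x * x) = (norm x)\<^sup>2"

instantiation complex :: cstar_algebra_1
begin

definition scaleC_complex :: "complex \<Rightarrow> complex \<Rightarrow> complex" where
  "scaleC_complex c x = c * x"

definition star_complex :: "complex \<Rightarrow> complex" where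
  "star_complex = cnj"

instance
  by standard
    (auto simp: scaleC_complex_def star_complex_def algebra_simps scaleR_conv_of_real
      norm_mult power2_eq_square)

end

subsection \<open>The algebra as a right Hilbert module over itself\<close>

text \<open>The inner product is $\langle x, y\rangle = x^* y$.\<close>

definition hinner :: "'a::cstar_algebra_1 \<Rightarrow> 'a \<Rightarrow> 'a" where
  "hinner x y = star x * y"

text \<open>The bounded operators on the module, $B(\mathcal{A})$.\<close>

definition module_ops :: "('a::cstar_algebra_1 \<Rightarrow> 'a) set" where
  "module_ops = {F. bounded_linear F \<and> (\<forall>c x. F (c *\<^sub>C x) = c *\<^sub>C F x) \<and>
     (\<forall>x a. F (x * a) = F x * a)}"

definition left_mult :: "'a::cstar_algebra_1 \<Rightarrow> 'a \<Rightarrow> 'a" where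
  "left_mult a = (\<lambda>x. a * x)"

lemma inj_left_mult: "inj (left_mult :: 'a::cstar_algebra_1 \<Rightarrow> 'a \<Rightarrow> 'a)"
  by (rule injI) (metis left_mult_def mult_1_right)

lemma range_left_mult: "range left_mult = (module_ops :: ('a::cstar_algebra_1 \<Rightarrow> 'a) set)"
proof (intro equalityI subsetI)
  fix F :: "'a \<Rightarrow> 'a" assume "F \<in> range left_mult"
  then show "F \<in> module_ops"
    by (auto simp: module_ops_def left_mult_def bounded_linear_mult_right
        mult_scaleC_right mult.assoc)
next
  fix F :: "'a \<Rightarrow> 'a" assume "F \<in> module_ops"
  then have "F x = left_mult (F 1) x" for x
    unfolding module_ops_def left_mult_def by (metis (mono_tags, lifting) mem_Collect_eq mult_1_left)
  then show "F \<in> range left_mult" by blast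
qed

definition closed_submodule :: "'a::cstar_algebra_1 set \<Rightarrow> bool" where
  "closed_submodule M \<longleftrightarrow> closed M \<and> 0 \<in> M \<and> (\<forall>x\<in>M. \<forall>y\<in>M. x + y \<in> M) \<and>
     (\<forall>c. \<forall>x\<in>M. c *\<^sub>C x \<in> M) \<and> (\<forall>x\<in>M. \<forall>a. x * a \<in> M)"

text \<open>The decomposition $\mathcal{A} = M \mathbin{\tilde\oplus} N$, not necessarily orthogonal.\<close>

definition direct_sum_decomp :: "'a::cstar_algebra_1 set \<Rightarrow> 'a set \<Rightarrow> bool" where
  "direct_sum_decomp M N \<longleftrightarrow> closed_submodule M \<and> closed_submodule N \<and>
     M \<inter> N = {0} \<and> {m + n | m n. m \<in> M \<and> n \<in> N} = UNIV"

definition orth_complement :: "'a::cstar_algebra_1 set \<Rightarrow> 'a set" where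
  "orth_complement M = {y. \<forall>x\<in>M. hinner x y = 0}"

text \<open>The orthogonal projection onto \<open>M\<close>. The description is proper exactly when \<open>M\<close> is
  orthogonally complementable, which holds for every complementable closed submodule.\<close>

definition orth_proj :: "'a::cstar_algebra_1 set \<Rightarrow> 'a \<Rightarrow> 'a" where
  "orth_proj M = (\<lambda>x. THE y. y \<in> M \<and> x - y \<in> orth_complement M)"

subsection \<open>Ideals of finite type elements\<close>

definition is_projection :: "'a::cstar_algebra_1 \<Rightarrow> bool" where
  "is_projection p \<longleftrightarrow> p * p = p \<and> star p = p"

text \<open>\<open>P\<close> is a net along the filter \<open>U\<close>. No monotonicity is required.\<close>

definition approximate_unit :: "'a::cstar_algebra_1 set \<Rightarrow> ('i \<Rightarrow> 'a) \<Rightarrow> 'i filter \<Rightarrow> bool" where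
  "approximate_unit S P U \<longleftrightarrow> U \<noteq> bot \<and>
     (\<forall>x\<in>S. ((\<lambda>i. P i * x) \<longlongrightarrow> x) U \<and> ((\<lambda>i. x * P i) \<longlongrightarrow> x) U)"

text \<open>By the following lemma, a net over an arbitrary index type may be replaced by the identity
  net along its image filter; so quantifying over filters on the algebra itself, as done in
  the definition of an ideal of finite type elements, loses no generality.\<close>

lemma approximate_unit_filtermap:
  "approximate_unit S (\<lambda>p. p) (filtermap P U) \<longleftrightarrow> approximate_unit S P U"
  by (simp add: approximate_unit_def filterlim_filtermap filtermap_bot_iff)

definition selfadjoint_ideal :: "'a::cstar_algebra_1 set \<Rightarrow> bool" where
  "selfadjoint_ideal S \<longleftrightarrow> 0 \<in> S \<and> (\<forall>x\<in>S. \<forall>y\<in>S. x + y \<in> S) \<and> (\<forall>c. \<forall>x\<in>S. c *\<^sub>C x \<in> S) \<and>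
     (\<forall>x\<in>S. \<forall>a. a * x \<in> S \<and> x * a \<in> S) \<and> (\<forall>x\<in>S. star x \<in> S)"

text \<open>For a projection \<^term>\<open>v * star v\<close>, the element \<^term>\<open>star v * v\<close> is a projection as well,
  and its orthogonality to \<open>p\<close> says that the product vanishes.\<close>

definition finite_type_ideal :: "'a::cstar_algebra_1 set \<Rightarrow> bool" where
  "finite_type_ideal S \<longleftrightarrow> selfadjoint_ideal S \<and>
     (\<exists>U. approximate_unit S (\<lambda>p. p) U \<and> (\<forall>\<^sub>F p in U. p \<in> S \<and> is_projection p)) \<and>
     (\<forall>p\<in>S. \<forall>q\<in>S. is_projection p \<longrightarrow> is_projection q \<longrightarrow>
        (\<exists>v. v * star v = q \<and> (star v * v) * p = 0))"

subsection \<open>Upper semi-Fredholm decompositions\<close>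

text \<open>The matrix of \<open>F\<close> is diagonal iff \<open>F\<close> maps \<open>M1\<close> into \<open>M2\<close> and \<open>N1\<close> into \<open>N2\<close>; its first
  diagonal entry is then the restriction of \<open>F\<close> to \<open>M1\<close>. Elements of \<open>S\<close> act by left
  multiplication.\<close>

definition mkphi_plus_decomp :: "'a::cstar_algebra_1 set \<Rightarrow> ('a \<Rightarrow> 'a) \<Rightarrow>
    'a set \<Rightarrow> 'a set \<Rightarrow> 'a set \<Rightarrow> 'a set \<Rightarrow> bool" where
  "mkphi_plus_decomp S F M1 N1 M2 N2 \<longleftrightarrow>
     direct_sum_decomp M1 N1 \<and> direct_sum_decomp M2 N2 \<and>
     F ` M1 \<subseteq> M2 \<and> F ` N1 \<subseteq> N2 \<and>
     bij_betw F M1 M2 \<and> (\<exists>K. \<forall>y\<in>M2. norm (inv_into M1 F y) \<le> K * norm y) \<and>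
     orth_proj N1 \<in> left_mult ` S"

definition mkphi_plus :: "'a::cstar_algebra_1 set \<Rightarrow> ('a \<Rightarrow> 'a) set" where
  "mkphi_plus S = {F \<in> module_ops. \<exists>M1 N1 M2 N2. mkphi_plus_decomp S F M1 N1 M2 N2}"

end

theory Submission
  imports Defs
begin

text \<open>Module maps on \<open>\<A>\<close> are left multiplications, so everything can be read off inside \<open>\<A>\<close>.
  A decomposition \<open>\<A> = M \<oplus> N\<close> is the same as an idempotent \<open>e\<close> with \<open>M = e\<A>\<close> and
  \<open>N = (1 - e)\<A>\<close>, and a decomposition of the operator \<open>F = L\<^sub>f\<close> yields, by extending the inverse of
  \<open>F\<close> on \<open>M\<^sub>1\<close> by zero on \<open>N\<^sub>2\<close>, an element \<open>a\<close> such that \<open>a f = e\<^sub>1\<close> and \<open>f a = e\<^sub>2\<close>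
  (in the proof of lemma \<open>mkphi_plus_decomp_parametrix\<close>).

  The orthogonal projection onto \<open>(1 - e)\<A>\<close> lies in an ideal \<open>\<F>\<close> if and only if the oblique one
  \<open>1 - e\<close> does, since each is a multiple of the other (lemma \<open>orth_proj_in_ideal_iff\<close>). Hence the
  assumption on \<open>N\<^sub>2\<close> says that \<open>f a = 1\<close> modulo \<open>\<F>\<close>, and the element \<open>b\<close> which belongs to the second
  decomposition satisfies \<open>b f = 1\<close> modulo \<open>\<F>\<close>. In the quotient ring \<open>\<A>/\<F>\<close> a left inverse and a
  right inverse coincide, so \<open>f b = 1\<close> modulo \<open>\<F>\<close>, which is the assertion.

  The analytic ingredient is that the range of every idempotent \<open>g\<close> is the range of a selfadjoint
  one (lemma \<open>idempotent_range_projection\<close>). It rests on the invertibility of \<open>1 - d\<close> for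
  skew-adjoint \<open>d\<close>, which comes from a Neumann series after a shift.\<close>

section \<open>The involution and Neumann series\<close>

lemma star_one [simp]: "star (1::'a::cstar_algebra_1) = 1"
  by (metis mult_1_left mult_1_right star_mult star_star)

lemma star_scaleR: "star (r *\<^sub>R (x::'a::cstar_algebra_1)) = r *\<^sub>R star x"
  by (simp add: scaleR_scaleC star_scaleC)

lemma star_minus: "star (- (x::'a::cstar_algebra_1)) = - star x"
  using star_scaleR[of "-1" x] by simp

lemma star_diff: "star ((x::'a::cstar_algebra_1) - y) = star x - star y"
  using star_add[of x "- y"] by (simp add: star_minus)

lemma Neumann_inverse:
  fixes x :: "'a::{real_normed_algebra_1, banach}"
  assumes "norm x < 1"
  shows "\<exists>y. (1 - x) * y = 1 \<and> y * (1 - x) = 1"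
proof -
  let ?y = "\<Sum>n. x ^ n"
  have s: "summable (\<lambda>n. x ^ n)"
    using assms by (rule complete_algebra_summable_geometric)
  have "?y = 1 + (\<Sum>n. x ^ Suc n)"
    using suminf_split_head[OF s] by simp
  moreover have "(\<Sum>n. x ^ Suc n) = x * ?y"
    using suminf_mult[OF s, of x] by simp
  moreover have "(\<Sum>n. x ^ Suc n) = ?y * x"
    using suminf_mult2[OF s, of x] by (simp add: power_commutes)
  ultimately have "(1 - x) * ?y = 1" "?y * (1 - x) = 1"
    by (simp_all add: algebra_simps)
  then show ?thesis by blast
qed

text \<open>The C*-identity bounds the norm of \<open>d + t\<close> by the root of \<open>\<parallel>d\<parallel>\<^sup>2 + t\<^sup>2\<close>, because the mixed terms of
  \<open>(d + t)\<^sup>* (d + t) = t\<^sup>2 - d\<^sup>2\<close> cancel. This is less than \<open>1 + t\<close> as soon as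
  \<open>\<parallel>d\<parallel>\<^sup>2 < 1 + 2 t\<close>, for instance for \<open>t = \<parallel>d\<parallel>\<^sup>2\<close>, and then the Neumann series inverts \<open>1 - d = (1 + t) - (d + t)\<close>.\<close>

lemma one_minus_skew_adjoint_invertible:
  fixes d :: "'a::cstar_algebra_1"
  assumes "star d = - d"
  shows "\<exists>y. (1 - d) * y = 1 \<and> y * (1 - d) = 1"
proof -
  define t where "t = (norm d)\<^sup>2"
  define z where "z = d + t *\<^sub>R 1"
  have t: "t \<ge> 0" by (simp add: t_def)
  have "star z * z = t\<^sup>2 *\<^sub>R 1 - d * d"
    by (simp add: z_def star_add star_scaleR assms algebra_simps power2_eq_square)
  then have "(norm z)\<^sup>2 \<le> norm (t\<^sup>2 *\<^sub>R (1::'a)) + norm (d * d)"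
    by (metis norm_star_mult_self norm_triangle_ineq4)
  also have "\<dots> \<le> t\<^sup>2 + t"
    using norm_mult_ineq[of d d] by (simp add: t_def power2_eq_square)
  also have "\<dots> < (1 + t)\<^sup>2"
    using t by (simp add: power2_eq_square algebra_simps)
  finally have "norm z < 1 + t"
    using t by (simp add: power_less_imp_less_base)
  then have "norm (inverse (1 + t) *\<^sub>R z) < 1"
    using t by (simp add: field_simps)
  from Neumann_inverse[OF this] obtain y where
    y: "(1 - inverse (1 + t) *\<^sub>R z) * y = 1" "y * (1 - inverse (1 + t) *\<^sub>R z) = 1" by blast
  have "1 - inverse (1 + t) *\<^sub>R z = inverse (1 + t) *\<^sub>R ((1 + t) *\<^sub>R 1 - z)"
    using t by (simp add: scaleR_diff_right)
  also have "(1 + t) *\<^sub>R 1 - z = 1 - d"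
    by (simp add: z_def algebra_simps)
  finally show ?thesis
    using y by (intro exI[of _ "inverse (1 + t) *\<^sub>R y"]) simp
qed

section \<open>Orthogonal projections onto ranges of idempotents\<close>

text \<open>Kaplansky's formula: \<open>u = g + g\<^sup>* - 1\<close> satisfies \<open>g u = g g\<^sup>* = u g\<^sup>*\<close> and
  \<open>u\<^sup>2 = 1 - d\<^sup>2 = (1 - d) (1 + d)\<close> for the skew-adjoint \<open>d = g - g\<^sup>*\<close>. So \<open>u\<close> is invertible, and
  \<open>g u\<^sup>-\<^sup>1\<close> is the projection sought.\<close>

lemma idempotent_range_projection:
  fixes g :: "'a::cstar_algebra_1"
  assumes "g * g = g"
  shows "\<exists>p. is_projection p \<and> g * p = p \<and> p * g = g"
proof -
  define d where "d = g - star g"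
  define u where "u = g + star g - 1"
  have gs: "star g * star g = star g"
    by (metis assms star_mult)
  have skew: "star d = - d" "star (- d) = - (- d)"
    by (simp_all add: d_def star_diff star_star star_minus)
  obtain r where r: "(1 - d) * r = 1" "r * (1 - d) = 1"
    using one_minus_skew_adjoint_invertible[OF skew(1)] by blast
  obtain s where s: "(1 + d) * s = 1" "s * (1 + d) = 1"
    using one_minus_skew_adjoint_invertible[OF skew(2)] by auto
  have uu: "u * u = (1 - d) * (1 + d)"
    by (simp add: u_def d_def algebra_simps assms gs)
  have right: "u * (u * (s * r)) = 1"
    by (metis uu r(1) s(1) mult.assoc mult_1_left)
  have left: "(s * r * u) * u = 1"
    by (metis uu r(2) s(2) mult.assoc mult_1_left)
  define w where "w = u * (s * r)"
  have uw: "u * w = 1" using right by (simp add: w_def)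
  have wu: "w * u = 1"
    by (metis uw left mult.assoc mult_1_left mult_1_right)
  have su: "star u = u"
    by (simp add: u_def star_add star_diff star_star add.commute)
  have sw: "star w = w"
    by (metis su uw wu star_mult star_one mult.assoc mult_1_left mult_1_right)
  have gu: "g * u = g * star g" "u * star g = g * star g"
    and gu': "star g * u = u * g"
    by (simp_all add: u_def algebra_simps assms gs)
  have wg: "w * g = star g * w"
    by (metis gu uw wu mult.assoc mult_1_left mult_1_right)
  have gw: "w * star g = g * w"
    by (metis gu' uw wu mult.assoc mult_1_left mult_1_right)
  have pg: "g * w * g = g"
    by (metis wg gu(1) uw mult.assoc mult_1_right)
  have "star (g * w) = g * w"
    by (simp add: star_mult sw gw)
  then have "is_projection (g * w)"
    using pg by (metis is_projection_def mult.assoc)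
  moreover have "g * (g * w) = g * w"
    by (metis assms mult.assoc)
  ultimately show ?thesis using pg by blast
qed

lemma orth_proj_range_projection:
  fixes p :: "'a::cstar_algebra_1"
  assumes "is_projection p"
  shows "orth_proj {x. p * x = x} = left_mult p"
proof
  fix x
  have pp: "p * p = p" "star p = p"
    using assms by (auto simp: is_projection_def)
  have ortho: "x - y \<in> orth_complement {x. p * x = x} \<longleftrightarrow> p * (x - y) = 0" for y
  proof
    assume "x - y \<in> orth_complement {x. p * x = x}"
    then show "p * (x - y) = 0"
      using pp by (auto simp: orth_complement_def hinner_def)
  next
    assume 0: "p * (x - y) = 0"
    have "star z * (x - y) = 0" if "p * z = z" for z
    proof -
      have "star z * (x - y) = star (p * z) * (x - y)" using that by simp
      also have "\<dots> = star z * (p * (x - y))" by (simp add: star_mult pp mult.assoc)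
      finally show ?thesis using 0 by simp
    qed
    then show "x - y \<in> orth_complement {x. p * x = x}"
      by (auto simp: orth_complement_def hinner_def)
  qed
  show "orth_proj {x. p * x = x} x = left_mult p x"
    unfolding orth_proj_def ortho left_mult_def
  proof (rule the_equality)
    show "p * x \<in> {x. p * x = x} \<and> p * (x - p * x) = 0"
      by (simp add: right_diff_distrib pp flip: mult.assoc)
  next
    fix y assume "y \<in> {x. p * x = x} \<and> p * (x - y) = 0"
    then show "y = p * x" by (simp add: right_diff_distrib)
  qed
qed

text \<open>The projection \<open>p\<close> and the idempotent \<open>g\<close> with the same range absorb each other, \<open>g p = p\<close>
  and \<open>p g = g\<close>, so an ideal contains both or neither.\<close>

lemma orth_proj_in_ideal_iff:
  fixes g :: "'a::cstar_algebra_1"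
  assumes S: "selfadjoint_ideal S" and g: "g * g = g"
  shows "orth_proj {x. g * x = x} \<in> left_mult ` S \<longleftrightarrow> g \<in> S"
proof -
  obtain p where p: "is_projection p" "g * p = p" "p * g = g"
    using idempotent_range_projection[OF g] by blast
  have "{x. g * x = x} = {x. p * x = x}"
    by (auto; metis p(2,3) mult.assoc)
  then have "orth_proj {x. g * x = x} = left_mult p"
    using orth_proj_range_projection[OF p(1)] by simp
  then have "orth_proj {x. g * x = x} \<in> left_mult ` S \<longleftrightarrow> p \<in> S"
    by (simp add: inj_image_mem_iff[OF inj_left_mult])
  also have "\<dots> \<longleftrightarrow> g \<in> S"
    using S p(2,3) unfolding selfadjoint_ideal_def by metis
  finally show ?thesis .
qed

section \<open>Decompositions as elements of the algebra\<close>

text \<open>The component of \<open>1\<close> in \<open>M\<close> is the idempotent: multiplying \<open>1 = e + n\<close> by \<open>x\<close> from the right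
  decomposes \<open>x\<close>, since both summands are right ideals.\<close>

lemma direct_sum_decomp_idempotent:
  fixes M N :: "'a::cstar_algebra_1 set"
  assumes "direct_sum_decomp M N"
  obtains e where "e * e = e" "M = {x. e * x = x}" "N = {x. (1 - e) * x = x}"
proof -
  have M: "closed_submodule M" and N: "closed_submodule N" and MN: "M \<inter> N = {0}"
    and sum: "{m + n | m n. m \<in> M \<and> n \<in> N} = UNIV"
    using assms by (auto simp: direct_sum_decomp_def)
  obtain e n where en: "e \<in> M" "n \<in> N" "1 = e + n"
    using sum by blast
  have n: "1 - e = n" using add_diff_cancel_left'[of e n] by (simp only: en(3))
  have in_M: "e * x \<in> M" and in_N: "(1 - e) * x \<in> N" for x
    using M N en(1,2) unfolding n by (auto simp: closed_submodule_def)
  have diff: "x - y \<in> K" if K: "closed_submodule K" and "x \<in> K" "y \<in> K" for x y K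
  proof -
    have "y * (- 1) \<in> K"
      using K that(3) by (simp only: closed_submodule_def)
    then have "x + y * (- 1) \<in> K"
      using K that(2) by (simp only: closed_submodule_def)
    then show ?thesis by simp
  qed
  have fix_M: "e * x = x" if "x \<in> M" for x
  proof -
    have "x - e * x \<in> M"
      by (rule diff[OF M that in_M])
    moreover have "x - e * x \<in> N"
      using in_N[of x] by (simp add: left_diff_distrib)
    ultimately have "x - e * x \<in> M \<inter> N" by (rule IntI)
    then show ?thesis by (simp add: MN)
  qed
  have kill_N: "e * x = 0" if "x \<in> N" for x
  proof -
    have "x - (1 - e) * x \<in> N"
      by (rule diff[OF N that in_N])
    then have "e * x \<in> N" by (simp add: left_diff_distrib)
    with in_M have "e * x \<in> M \<inter> N" by (rule IntI)
    then show ?thesis by (simp add: MN)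
  qed
  show thesis
  proof
    show "e * e = e" using fix_M en(1) by blast
    show "M = {x. e * x = x}"
    proof (intro set_eqI iffI)
      show "x \<in> {x. e * x = x}" if "x \<in> M" for x
        using fix_M[OF that] by simp
      show "x \<in> M" if "x \<in> {x. e * x = x}" for x
        using in_M[of x] that by simp
    qed
    show "N = {x. (1 - e) * x = x}"
    proof (intro set_eqI iffI)
      show "x \<in> {x. (1 - e) * x = x}" if "x \<in> N" for x
        using kill_N[OF that] by (simp add: left_diff_distrib)
      show "x \<in> N" if "x \<in> {x. (1 - e) * x = x}" for x
        using in_N[of x] that by simp
    qed
  qed
qed

text \<open>The element \<open>a\<close> is the preimage in \<open>M1\<close> of \<open>e2\<close>; left multiplication by it inverts \<open>F\<close> from \<open>M1\<close>
  onto \<open>M2\<close> and vanishes on \<open>N2\<close>.\<close>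

lemma mkphi_plus_decomp_parametrix:
  fixes S :: "'a::cstar_algebra_1 set"
  assumes S: "selfadjoint_ideal S" and D: "mkphi_plus_decomp S (left_mult f) M1 N1 M2 N2"
  obtains a where "1 - a * f \<in> S" "orth_proj N2 \<in> left_mult ` S \<longleftrightarrow> 1 - f * a \<in> S"
proof -
  have D1: "direct_sum_decomp M1 N1" and D2: "direct_sum_decomp M2 N2"
    and FM: "\<And>x. x \<in> M1 \<Longrightarrow> f * x \<in> M2" and FN: "\<And>x. x \<in> N1 \<Longrightarrow> f * x \<in> N2"
    and bij: "bij_betw (left_mult f) M1 M2"
    and PN1: "orth_proj N1 \<in> left_mult ` S"
    using D by (auto simp: mkphi_plus_decomp_def left_mult_def)
  obtain e1 where e1: "e1 * e1 = e1" "M1 = {x. e1 * x = x}" "N1 = {x. (1 - e1) * x = x}"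
    using direct_sum_decomp_idempotent[OF D1] by blast
  obtain e2 where e2: "e2 * e2 = e2" "M2 = {x. e2 * x = x}" "N2 = {x. (1 - e2) * x = x}"
    using direct_sum_decomp_idempotent[OF D2] by blast
  have idem: "(1 - e1) * (1 - e1) = 1 - e1" "(1 - e2) * (1 - e2) = 1 - e2"
    by (simp_all add: algebra_simps e1(1) e2(1))
  have inj: "x = y" if "x \<in> M1" "y \<in> M1" "f * x = f * y" for x y
    using bij that unfolding bij_betw_def inj_on_def left_mult_def by blast
  have "e2 \<in> M2" using e2 by simp
  then obtain a where a: "a \<in> M1" "f * a = e2"
    using bij by (auto simp: bij_betw_def left_mult_def)
  have "e1 * a = a" using a(1) e1(2) by simp
  then have right_ideal: "a * x \<in> M1" for x
    unfolding e1(2) by (simp flip: mult.assoc)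
  have "f * e1 \<in> M2" "f * (1 - e1) \<in> N2"
    by (rule FM FN; simp add: e1 idem)+
  then have "e2 * (f * e1) = f * e1" "e2 * (f * (1 - e1)) = 0"
    by (simp_all add: e2 algebra_simps)
  then have comm: "e2 * f = f * e1"
    by (simp add: right_diff_distrib)
  have "a * f = e1"
  proof (rule inj)
    show "e1 \<in> M1" using e1 by simp
    show "f * (a * f) = f * e1" using a(2) comm by (simp flip: mult.assoc)
  qed (rule right_ideal)
  then have "1 - a * f \<in> S"
    using PN1 orth_proj_in_ideal_iff[OF S idem(1)] e1(3) by simp
  moreover have "orth_proj N2 \<in> left_mult ` S \<longleftrightarrow> 1 - f * a \<in> S"
    using orth_proj_in_ideal_iff[OF S idem(2)] e2(3) a(2) by simp
  ultimately show thesis by (rule that)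
qed

section \<open>Comparing two decompositions\<close>

lemma left_inverse_is_right_inverse_mod_ideal:
  fixes S :: "'a::cstar_algebra_1 set"
  assumes S: "selfadjoint_ideal S"
    and a: "1 - f * a \<in> S" and b: "1 - b * f \<in> S"
  shows "1 - f * b \<in> S"
proof -
  have add: "x + y \<in> S" if "x \<in> S" "y \<in> S" for x y
    using S that by (auto simp: selfadjoint_ideal_def)
  have mult: "c * x \<in> S" "x * c \<in> S" if "x \<in> S" for x c
    using S that by (auto simp: selfadjoint_ideal_def)
  \<comment> \<open>Both \<open>a\<close> and \<open>b\<close> are congruent to \<open>b f a\<close>.\<close>
  have "1 - f * b = f * ((1 - b * f) * a) + f * (- b) * (1 - f * a) + (1 - f * a)"
    by (simp add: algebra_simps)
  then show ?thesis
    using add[OF add[OF mult(1)[OF mult(2)[OF b]] mult(1)[OF a]] a] by metis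
qed

theorem lemma3p2:
  fixes S :: "'a::cstar_algebra_1 set"
    and F :: "'a \<Rightarrow> 'a"
    and M1 N1 M2 N2 M1' N1' M2' N2' :: "'a set"
  assumes "finite_type_ideal S"
    and "F \<in> mkphi_plus S"
    and "mkphi_plus_decomp S F M1 N1 M2 N2"
    and "mkphi_plus_decomp S F M1' N1' M2' N2'"
    and "orth_proj N2 \<in> left_mult ` S"
  shows "orth_proj N2' \<in> left_mult ` S"
proof -
  have S: "selfadjoint_ideal S"
    using assms(1) by (simp add: finite_type_ideal_def)
  have "F \<in> range left_mult"
    using assms(2) by (simp add: mkphi_plus_def range_left_mult)
  then obtain f where F: "F = left_mult f" by blast
  obtain a where a: "1 - f * a \<in> S"
    using mkphi_plus_decomp_parametrix[OF S assms(3)[unfolded F]] assms(5) by blast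
  obtain b where b: "1 - b * f \<in> S" "orth_proj N2' \<in> left_mult ` S \<longleftrightarrow> 1 - f * b \<in> S"
    using mkphi_plus_decomp_parametrix[OF S assms(4)[unfolded F]] by blast
  show ?thesis
    using left_inverse_is_right_inverse_mod_ideal[OF S a b(1)] b(2) by simp
qed

end
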